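(* Let $S$ be a semigroup and let $\sigma:S\to S$ be an automorphism (not necessarily involutive). The solutions $f,g:S\to\mathbb{C}$ of the functional equation $$f(x\sigma(y))=f(x)g(y)+f(y)g(x),\quad x,y\in S,$$ are exactly the following pairs: (1) $f=0$ and $g$ is arbitrary. (2) $f$ is any non-zero function such that $f=0$ on $S^2$, while $g=0$. (3) $f=\dfrac{1}{2\alpha}\chi$ and $g=\dfrac12\chi$, where $\chi:S\to\mathbb{C}$ is a non-zero multiplicative function such that $\chi^*=\chi$ and $\alpha\in\mathbb{C}\setminus\{0\}$. (4) $f=c(\chi_1-\chi_2)$ and $g=\dfrac{\chi_1+\chi_2}{2}$, where $\chi_1,\chi_2:S\to\mathbb{C}$ are two different multiplicative functions such that $\chi_1^*=\chi_1$, $\chi_2^*=\chi_2$, and $c\in\mathbb{C}\setminus\{0\}$. (5) $f=\phi_\chi$ and $g=\chi$, where $\chi:S\to\mathbb{C}$ is a non-zero multiplicative function and $\phi_\chi:S\to\mathbb{C}$ satisfies $\phi_\chi(xy)=\phi_\chi(x)\chi(y)+\phi_\chi(y)\chi(x)$ for all $x,y\in S$, such that $\chi^*=\chi$ and $\phi_\chi^*=\phi_\chi$. Moreover, off the exceptional case (1), $f$ and $g$ are abelian. Furthermore, off the exceptional case (1), if $S$ is a topological semigroup and $f\in C(S)$, then $g,\chi,\chi_1,\chi_2,\phi_\chi\in C(S)$ (for those of these functions that occur in the respective case).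
   Context: A semigroup is a set with an associative binary operation. An automorphism $\sigma:S\to S$ is a bijection with $\sigma(xy)=\sigma(x)\sigma(y)$ for all $x,y\in S$. A function $\mu:S\to\mathbb{C}$ is multiplicative if $\mu(xy)=\mu(x)\mu(y)$ for all $x,y\in S$ (the zero function is allowed). For $f:S\to\mathbb{C}$, put $f^*:=f\circ\sigma$. $S^2:=\{xy\mid x,y\in S\}$. A function $f:S\to\mathbb{C}$ is central if $f(xy)=f(yx)$ for all $x,y\in S$, and abelian if it is central and $f(xyz)=f(xzy)$ for all $x,y,z\in S$. A topological semigroup is a semigroup with a topology such that the product $(x,y)\mapsto xy$ is continuous from $S\times S$ (product topology) to $S$; then $C(S)$ denotes the set of continuous functions $S\to\mathbb{C}$. (The automorphism $\sigma$ is not assumed continuous.) The exceptional case (1) is the case $f=0$. *)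

theory Defs
  imports "HOL-Analysis.Analysis"
begin

definition semigroup_automorphism :: "('a::semigroup_mult \<Rightarrow> 'a) \<Rightarrow> bool" where
  "semigroup_automorphism \<sigma> \<longleftrightarrow> bij \<sigma> \<and> (\<forall>x y. \<sigma> (x * y) = \<sigma> x * \<sigma> y)"

text \<open>The zero function counts as multiplicative.\<close>

definition multiplicative :: "('a::semigroup_mult \<Rightarrow> complex) \<Rightarrow> bool" where
  "multiplicative \<mu> \<longleftrightarrow> (\<forall>x y. \<mu> (x * y) = \<mu> x * \<mu> y)"

definition semigroup_square :: "'a::semigroup_mult set" where
  "semigroup_square = {x * y | x y. True}"

definition central :: "('a::semigroup_mult \<Rightarrow> complex) \<Rightarrow> bool" where
  "central f \<longleftrightarrow> (\<forall>x y. f (x * y) = f (y * x))"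

definition abelian :: "('a::semigroup_mult \<Rightarrow> complex) \<Rightarrow> bool" where
  "abelian f \<longleftrightarrow> central f \<and> (\<forall>x y z. f (x * y * z) = f (x * z * y))"

text \<open>The topology is an explicit object rather than a type class instance, so that the algebraic
  and the topological part of a result can concern one and the same semigroup.\<close>

definition topological_semigroup :: "'a::semigroup_mult topology \<Rightarrow> bool" where
  "topological_semigroup T \<longleftrightarrow>
     topspace T = UNIV \<and> continuous_map (prod_topology T T) T (\<lambda>(x, y). x * y)"

definition continuous_functions :: "'a topology \<Rightarrow> ('a \<Rightarrow> complex) set" where
  "continuous_functions T = {f. continuous_map T euclidean f}"

definition solves_sine_equation ::
    "('a::semigroup_mult \<Rightarrow> 'a) \<Rightarrow> ('a \<Rightarrow> complex) \<Rightarrow> ('a \<Rightarrow> complex) \<Rightarrow> bool" where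
  "solves_sine_equation \<sigma> f g \<longleftrightarrow> (\<forall>x y. f (x * \<sigma> y) = f x * g y + f y * g x)"

text \<open>The parametrised families of solutions. The function written $f^*$ in the literature is
  \<open>f \<circ> \<sigma>\<close>.\<close>

definition single_character_form ::
    "('a::semigroup_mult \<Rightarrow> 'a) \<Rightarrow> ('a \<Rightarrow> complex) \<Rightarrow> ('a \<Rightarrow> complex)
      \<Rightarrow> complex \<Rightarrow> ('a \<Rightarrow> complex) \<Rightarrow> bool" where
  "single_character_form \<sigma> f g \<alpha> \<mu> \<longleftrightarrow>
     \<alpha> \<noteq> 0 \<and> multiplicative \<mu> \<and> \<mu> \<noteq> (\<lambda>_. 0) \<and> \<mu> \<circ> \<sigma> = \<mu> \<and>
     f = (\<lambda>x. 1 / (2 * \<alpha>) * \<mu> x) \<and> g = (\<lambda>x. 1 / 2 * \<mu> x)"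

definition two_character_form ::
    "('a::semigroup_mult \<Rightarrow> 'a) \<Rightarrow> ('a \<Rightarrow> complex) \<Rightarrow> ('a \<Rightarrow> complex)
      \<Rightarrow> complex \<Rightarrow> ('a \<Rightarrow> complex) \<Rightarrow> ('a \<Rightarrow> complex) \<Rightarrow> bool" where
  "two_character_form \<sigma> f g c \<mu>\<^sub>1 \<mu>\<^sub>2 \<longleftrightarrow>
     c \<noteq> 0 \<and> multiplicative \<mu>\<^sub>1 \<and> multiplicative \<mu>\<^sub>2 \<and> \<mu>\<^sub>1 \<noteq> \<mu>\<^sub>2 \<and>
     \<mu>\<^sub>1 \<circ> \<sigma> = \<mu>\<^sub>1 \<and> \<mu>\<^sub>2 \<circ> \<sigma> = \<mu>\<^sub>2 \<and>
     f = (\<lambda>x. c * (\<mu>\<^sub>1 x - \<mu>\<^sub>2 x)) \<and> g = (\<lambda>x. (\<mu>\<^sub>1 x + \<mu>\<^sub>2 x) / 2)"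

definition sine_addition_form ::
    "('a::semigroup_mult \<Rightarrow> 'a) \<Rightarrow> ('a \<Rightarrow> complex) \<Rightarrow> ('a \<Rightarrow> complex)
      \<Rightarrow> ('a \<Rightarrow> complex) \<Rightarrow> ('a \<Rightarrow> complex) \<Rightarrow> bool" where
  "sine_addition_form \<sigma> f g \<mu> \<phi> \<longleftrightarrow>
     multiplicative \<mu> \<and> \<mu> \<noteq> (\<lambda>_. 0) \<and>
     (\<forall>x y. \<phi> (x * y) = \<phi> x * \<mu> y + \<phi> y * \<mu> x) \<and>
     \<mu> \<circ> \<sigma> = \<mu> \<and> \<phi> \<circ> \<sigma> = \<phi> \<and> f = \<phi> \<and> g = \<mu>"

end

theory Submission
  imports Defs
begin

text \<open>
  Write the sine equation as $f(x\sigma(y)) = f(x)g(y) + f(y)g(x)$ with $f \neq 0$. The dichotomy is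
  whether \<open>g\<close> is a scalar multiple of \<open>f\<close>.

  If $g = \lambda f$, the equation is $f(x\sigma(y)) = 2\lambda f(x)f(y)$. For $\lambda = 0$ it says
  that \<open>f\<close> vanishes on products, because \<open>\<sigma>\<close> is onto. For $\lambda \neq 0$, the function
  $\chi = 2\lambda f$ satisfies $\chi(x\sigma(y)) = \chi(x)\chi(y)$, and evaluating
  $\chi(x\sigma(y)\sigma(z))$ with the two bracketings shows that \<open>\<chi>\<close> is multiplicative and
  hence \<open>\<sigma>\<close>-invariant (\<open>multiplicative_of_twisted\<close>).

  If \<open>f\<close> and \<open>g\<close> are linearly independent, the same two bracketings of $f(x\sigma(y)\sigma(z))$ and
  comparison of coefficients of $f(x)$ and $g(x)$ give ordinary, untwisted addition formulas with
  unknown coefficient functions \<open>a\<close>, \<open>b\<close>. Applying these to the product $x \cdot \sigma(y)$ and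
  comparing with the original equation forces $f \circ \sigma = f$, $g \circ \sigma = g$, $b = g$ and $a = \rho f$
  for a constant \<open>\<rho>\<close> (\<open>untwisted_addition_formulas\<close>). So \<open>\<sigma>\<close> disappears from the equation and
  \[ f(xy) = f(x)g(y) + f(y)g(x), \qquad g(xy) = g(x)g(y) + \rho f(x)f(y). \]
  If $\rho = 0$, then \<open>g\<close> is multiplicative. If $\rho = d^2 \neq 0$, then $g + df$ and $g - df$ are
  two different multiplicative functions. In both cases \<open>f\<close> and \<open>g\<close> have the required form.

  Commutativity of complex multiplication makes every solution abelian. Continuity passes from \<open>f\<close>
  to \<open>g\<close> by solving the equation for $g(x)$ at a fixed \<open>y\<close> with $f(y) \neq 0$; then \<open>\<sigma>\<close>
  enters only through the right translation by the single element $\sigma(y)$, which is continuous.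
  The multiplicative functions are linear combinations of \<open>f\<close> and \<open>g\<close>.
\<close>

section \<open>Each listed pair is a solution\<close>

lemma solves_sine_equation_if_zero_on_square:
  assumes "\<forall>s \<in> semigroup_square. f s = 0" and "g = (\<lambda>_. 0)"
  shows "solves_sine_equation \<sigma> f g"
  using assms unfolding solves_sine_equation_def semigroup_square_def by auto

lemma solves_sine_equation_if_single_character:
  assumes "single_character_form \<sigma> f g \<alpha> \<mu>"
  shows "solves_sine_equation \<sigma> f g"
proof -
  have "\<mu> (x * \<sigma> y) = \<mu> x * \<mu> y" for x y
    using assms unfolding single_character_form_def multiplicative_def by (metis comp_apply)
  then show ?thesis
    using assms unfolding single_character_form_def solves_sine_equation_def
    by (auto simp: field_simps)
qed

lemma solves_sine_equation_if_two_character: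
  assumes "two_character_form \<sigma> f g c \<mu>\<^sub>1 \<mu>\<^sub>2"
  shows "solves_sine_equation \<sigma> f g"
proof -
  have "\<mu>\<^sub>1 (x * \<sigma> y) = \<mu>\<^sub>1 x * \<mu>\<^sub>1 y" "\<mu>\<^sub>2 (x * \<sigma> y) = \<mu>\<^sub>2 x * \<mu>\<^sub>2 y" for x y
    using assms unfolding two_character_form_def multiplicative_def by (metis comp_apply)+
  then show ?thesis
    using assms unfolding two_character_form_def solves_sine_equation_def
    by (auto simp: field_simps)
qed

lemma solves_sine_equation_if_sine_addition:
  assumes "sine_addition_form \<sigma> f g \<mu> \<phi>"
  shows "solves_sine_equation \<sigma> f g"
proof -
  have "\<mu> (\<sigma> y) = \<mu> y" "\<phi> (\<sigma> y) = \<phi> y" for y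
    using assms unfolding sine_addition_form_def by (metis comp_apply)+
  then show ?thesis
    using assms unfolding sine_addition_form_def solves_sine_equation_def by auto
qed

section \<open>Linearly dependent solutions\<close>

text \<open>The value at $x\,\sigma(y)\,\sigma(z) = x\,\sigma(yz)$ is $F(x)F(yz)$ by one bracketing and
  $F(x)F(y)F(z)$ by the other, so $F(x)$ can be cancelled at a point where it is non-zero.\<close>

lemma multiplicative_of_twisted:
  fixes F :: "'a::semigroup_mult \<Rightarrow> complex"
  assumes hom: "\<And>x y. \<sigma> (x * y) = \<sigma> x * \<sigma> y"
    and F: "\<And>x y. F (x * \<sigma> y) = F x * F y"
    and nz: "F \<noteq> (\<lambda>_. 0)"
  shows "multiplicative F" and "F \<circ> \<sigma> = F"
proof -
  obtain x where x: "F x \<noteq> 0"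
    using nz by auto
  have mult: "F (y * z) = F y * F z" for y z
  proof -
    have "F x * F (y * z) = F (x * \<sigma> y * \<sigma> z)"
      by (metis F hom mult.assoc)
    also have "\<dots> = F x * (F y * F z)"
      by (simp add: F)
    finally show ?thesis
      using x by simp
  qed
  then show "multiplicative F"
    unfolding multiplicative_def by blast
  have "F x * F (\<sigma> y) = F x * F y" for y
    by (metis mult F)
  then show "F \<circ> \<sigma> = F"
    using x by (auto simp: fun_eq_iff)
qed

lemma dependent_solution:
  assumes aut: "semigroup_automorphism \<sigma>"
    and sol: "solves_sine_equation \<sigma> f g"
    and nz: "f \<noteq> (\<lambda>_. 0)"
    and dep: "\<And>x. g x = k * f x"
  shows "((\<forall>s \<in> semigroup_square. f s = 0) \<and> g = (\<lambda>_. 0))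
         \<or> (\<exists>\<alpha> \<mu>. single_character_form \<sigma> f g \<alpha> \<mu>)"
proof (cases "k = 0")
  case True
  then have g: "g = (\<lambda>_. 0)"
    using dep by auto
  have "f (x * y) = 0" for x y
  proof -
    obtain z where "y = \<sigma> z"
      using aut unfolding semigroup_automorphism_def by (metis bij_pointE)
    then show ?thesis
      using sol g unfolding solves_sine_equation_def by simp
  qed
  then show ?thesis
    using g unfolding semigroup_square_def by auto
next
  case False
  define F where "F = (\<lambda>x. 2 * k * f x)"
  have eq: "F (x * \<sigma> y) = F x * F y" for x y
    using sol dep unfolding solves_sine_equation_def F_def by (simp add: algebra_simps)
  have hom: "\<sigma> (x * y) = \<sigma> x * \<sigma> y" for x y
    using aut unfolding semigroup_automorphism_def by blast
  have Fnz: "F \<noteq> (\<lambda>_. 0)"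
    using nz False unfolding F_def by (auto simp: fun_eq_iff)
  have "single_character_form \<sigma> f g k F"
    unfolding single_character_form_def
    using False Fnz multiplicative_of_twisted[OF hom eq Fnz] dep
    by (auto simp: F_def)
  then show ?thesis
    by blast
qed

section \<open>Linearly independent solutions\<close>

lemma independent_coefficients:
  fixes f g :: "'a \<Rightarrow> complex"
  assumes nz: "f \<noteq> (\<lambda>_. 0)"
    and indep: "\<nexists>k. \<forall>x. g x = k * f x"
    and rel: "\<And>x. p * f x + q * g x = 0"
  shows "p = 0" and "q = 0"
proof -
  show q: "q = 0"
  proof (rule ccontr)
    assume "q \<noteq> 0"
    then have "g x = (- p / q) * f x" for x
      using rel[of x] by (simp add: field_simps add_eq_0_iff)
    then show False
      using indep by blast
  qed
  obtain x where "f x \<noteq> 0"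
    using nz by auto
  then show "p = 0"
    using rel[of x] q by simp
qed

text \<open>The removal of the twist. Comparing coefficients of \<open>f\<close> and \<open>g\<close> is applied repeatedly, each
  time to an identity that holds for all values of a first variable while the others are fixed.\<close>

lemma untwisted_addition_formulas:
  assumes aut: "semigroup_automorphism \<sigma>"
    and sol: "solves_sine_equation \<sigma> f g"
    and nz: "f \<noteq> (\<lambda>_. 0)"
    and indep: "\<nexists>k. \<forall>x. g x = k * f x"
  obtains \<rho> where "\<And>x y. f (x * y) = f x * g y + f y * g x"
    and "\<And>x y. g (x * y) = g x * g y + \<rho> * (f x * f y)"
    and "f \<circ> \<sigma> = f" and "g \<circ> \<sigma> = g"
proof -
  note coeffs = independent_coefficients[OF nz indep]
  have eq: "f (x * \<sigma> y) = f x * g y + f y * g x" for x y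
    using sol unfolding solves_sine_equation_def by blast
  have hom: "\<sigma> (x * y) = \<sigma> x * \<sigma> y" for x y
    using aut unfolding semigroup_automorphism_def by blast
  \<comment> \<open>The two bracketings of \<open>f (x * \<sigma> y * \<sigma> z)\<close>.\<close>
  have assoc: "f x * g (y * z) + f (y * z) * g x
      = (f x * g y + f y * g x) * g z + f z * g (x * \<sigma> y)" for x y z
    by (metis eq hom mult.assoc)
  obtain z\<^sub>0 where z0: "f z\<^sub>0 \<noteq> 0"
    using nz by auto
  define a where "a y = (g (y * z\<^sub>0) - g y * g z\<^sub>0) / f z\<^sub>0" for y
  define b where "b y = (f (y * z\<^sub>0) - f y * g z\<^sub>0) / f z\<^sub>0" for y
  have g_twisted: "g (x * \<sigma> y) = f x * a y + g x * b y" for x y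
  proof -
    have "f z\<^sub>0 * a y = g (y * z\<^sub>0) - g y * g z\<^sub>0" "f z\<^sub>0 * b y = f (y * z\<^sub>0) - f y * g z\<^sub>0"
      using z0 unfolding a_def b_def by simp_all
    moreover have "f z\<^sub>0 * g (x * \<sigma> y)
        = f x * (g (y * z\<^sub>0) - g y * g z\<^sub>0) + g x * (f (y * z\<^sub>0) - f y * g z\<^sub>0)"
      using assoc[of x y z\<^sub>0] by (simp add: algebra_simps)
    ultimately have "f z\<^sub>0 * g (x * \<sigma> y) = f z\<^sub>0 * (f x * a y + g x * b y)"
      by (metis distrib_left mult.left_commute)
    then show ?thesis
      using z0 by simp
  qed
  have cmp1: "(g (y * z) - g y * g z - f z * a y) * f x
      + (f (y * z) - f y * g z - f z * b y) * g x = 0" for x y z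
    using assoc[of x y z] by (simp add: g_twisted algebra_simps)
  have g_prod: "g (y * z) = g y * g z + f z * a y" for y z
    using coeffs(1)[OF cmp1] by (simp add: algebra_simps)
  have f_prod: "f (y * z) = f y * g z + f z * b y" for y z
    using coeffs(2)[OF cmp1] by (simp add: algebra_simps)
  \<comment> \<open>The twisted and the untwisted formulas evaluate \<open>f (x * \<sigma> y)\<close> and \<open>g (x * \<sigma> y)\<close> in two ways.\<close>
  have f_cmp: "f (\<sigma> y) * b x = f x * (g y - g (\<sigma> y)) + f y * g x" for x y
    using eq[of x y] f_prod[of x "\<sigma> y"] by (simp add: algebra_simps)
  have g_cmp: "f (\<sigma> y) * a x = f x * a y + g x * (b y - g (\<sigma> y))" for x y
    using g_twisted[of x y] g_prod[of x "\<sigma> y"] by (simp add: algebra_simps)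
  \<comment> \<open>Dividing by \<open>f (\<sigma> w)\<close>, which is non-zero, puts \<open>a\<close> and \<open>b\<close> in the span of \<open>f\<close> and \<open>g\<close>.\<close>
  obtain w where w: "f (\<sigma> w) \<noteq> 0"
    using aut z0 unfolding semigroup_automorphism_def by (metis bij_pointE)
  define \<beta> \<kappa> \<rho> \<tau>
    where "\<beta> = (g w - g (\<sigma> w)) / f (\<sigma> w)" and "\<kappa> = f w / f (\<sigma> w)"
      and "\<rho> = a w / f (\<sigma> w)" and "\<tau> = (b w - g (\<sigma> w)) / f (\<sigma> w)"
  have b_span: "b x = \<beta> * f x + \<kappa> * g x" for x
    using f_cmp[of w x] w unfolding \<beta>_def \<kappa>_def by (simp add: field_simps)
  have a_span: "a x = \<rho> * f x + \<tau> * g x" for x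
    using g_cmp[of w x] w unfolding \<rho>_def \<tau>_def by (simp add: field_simps)
  have cmp2: "(f (\<sigma> y) * \<beta> - (g y - g (\<sigma> y))) * f x + (f (\<sigma> y) * \<kappa> - f y) * g x = 0" for x y
    using f_cmp[of y x] unfolding b_span by (simp add: algebra_simps)
  have cmp3: "(f (\<sigma> y) * \<rho> - a y) * f x + (f (\<sigma> y) * \<tau> - (b y - g (\<sigma> y))) * g x = 0" for x y
    using g_cmp[of y x] unfolding a_span[of x] by (simp add: algebra_simps)
  have g_\<sigma>: "g (\<sigma> y) = g y - f (\<sigma> y) * \<beta>" for y
    using coeffs(1)[OF cmp2, of y] by (simp add: algebra_simps)
  have f_\<sigma>: "f y = f (\<sigma> y) * \<kappa>" for y
    using coeffs(2)[OF cmp2, of y] by simp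
  have a_\<sigma>: "a y = f (\<sigma> y) * \<rho>" for y
    using coeffs(1)[OF cmp3, of y] by simp
  have b_\<sigma>: "b y = g (\<sigma> y) + f (\<sigma> y) * \<tau>" for y
    using coeffs(2)[OF cmp3, of y] by (simp add: algebra_simps)
  \<comment> \<open>Eliminating \<open>f (\<sigma> y)\<close> and \<open>g (\<sigma> y)\<close> leaves two linear relations between \<open>f\<close> and
    \<open>g\<close>. Independence makes their coefficients vanish, which fixes the constants: \<open>\<tau> = 0\<close>,
    \<open>\<kappa> = 1\<close> (as \<open>\<kappa> \<noteq> 0\<close>) and then \<open>2 * \<beta> = 0\<close>.\<close>
  have "(\<kappa> * \<rho> - \<rho>) * f y + (\<kappa> * \<tau>) * g y = 0" for y
  proof -
    have "\<kappa> * (\<rho> * f y + \<tau> * g y) = \<rho> * (f (\<sigma> y) * \<kappa>)"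
      using a_\<sigma>[of y] a_span[of y] by simp
    then show ?thesis
      using f_\<sigma>[of y] by (simp add: algebra_simps)
  qed
  from coeffs(2)[OF this] have \<tau>: "\<tau> = 0"
    using f_\<sigma>[of z\<^sub>0] z0 by auto
  have "(\<kappa> * \<beta> + \<beta>) * f y + (\<kappa> * \<kappa> - \<kappa>) * g y = 0" for y
  proof -
    have "\<beta> * f y + \<kappa> * g y = g y - f (\<sigma> y) * \<beta>"
      using b_\<sigma>[of y] b_span[of y] g_\<sigma>[of y] \<tau> by simp
    then have "\<kappa> * (\<beta> * f y + \<kappa> * g y) = \<kappa> * (g y - f (\<sigma> y) * \<beta>)"
      by (rule arg_cong)
    then show ?thesis
      using f_\<sigma>[of y] by (simp add: algebra_simps)
  qed
  from coeffs[OF this] have \<kappa>: "\<kappa> = 1" and \<beta>: "\<beta> = 0"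
    using f_\<sigma>[of z\<^sub>0] z0 by auto
  show thesis
  proof
    show "f (x * y) = f x * g y + f y * g x" for x y
      using f_prod[of x y] b_span[of x] \<kappa> \<beta> by simp
    show "g (x * y) = g x * g y + \<rho> * (f x * f y)" for x y
      using g_prod[of x y] a_span[of x] \<tau> by simp
    show "f \<circ> \<sigma> = f"
      using f_\<sigma>[symmetric] \<kappa> by (simp add: fun_eq_iff)
    show "g \<circ> \<sigma> = g"
      using g_\<sigma> \<beta> by (simp add: fun_eq_iff)
  qed
qed

lemma independent_solution:
  assumes aut: "semigroup_automorphism \<sigma>"
    and sol: "solves_sine_equation \<sigma> f g"
    and nz: "f \<noteq> (\<lambda>_. 0)"
    and indep: "\<nexists>k. \<forall>x. g x = k * f x"
  shows "(\<exists>c \<mu>\<^sub>1 \<mu>\<^sub>2. two_character_form \<sigma> f g c \<mu>\<^sub>1 \<mu>\<^sub>2)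
         \<or> (\<exists>\<mu> \<phi>. sine_addition_form \<sigma> f g \<mu> \<phi>)"
proof -
  obtain \<rho> where f_prod: "\<And>x y. f (x * y) = f x * g y + f y * g x"
    and g_prod: "\<And>x y. g (x * y) = g x * g y + \<rho> * (f x * f y)"
    and inv: "f \<circ> \<sigma> = f" "g \<circ> \<sigma> = g"
    using untwisted_addition_formulas[OF assms] by metis
  show ?thesis
  proof (cases "\<rho> = 0")
    case True
    have "g \<noteq> (\<lambda>_. 0)"
      using indep by (metis mult_zero_left)
    then have "sine_addition_form \<sigma> f g g f"
      unfolding sine_addition_form_def multiplicative_def
      using True f_prod g_prod inv by auto
    then show ?thesis
      by blast
  next
    case False
    define d where "d = csqrt \<rho>"
    have d: "d * d = \<rho>" "d \<noteq> 0"
      using False power2_csqrt[of \<rho>] unfolding d_def power2_eq_square by auto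
    define \<mu>\<^sub>1 \<mu>\<^sub>2 where "\<mu>\<^sub>1 x = g x + d * f x" and "\<mu>\<^sub>2 x = g x - d * f x" for x
    have "multiplicative \<mu>\<^sub>1" "multiplicative \<mu>\<^sub>2"
      unfolding multiplicative_def \<mu>\<^sub>1_def \<mu>\<^sub>2_def f_prod g_prod d(1)[symmetric]
      by (auto simp: algebra_simps)
    moreover have "\<mu>\<^sub>1 \<noteq> \<mu>\<^sub>2"
      using nz d(2) unfolding \<mu>\<^sub>1_def \<mu>\<^sub>2_def fun_eq_iff by (auto simp: algebra_simps)
    moreover have "\<mu>\<^sub>1 \<circ> \<sigma> = \<mu>\<^sub>1" "\<mu>\<^sub>2 \<circ> \<sigma> = \<mu>\<^sub>2"
      using inv unfolding \<mu>\<^sub>1_def \<mu>\<^sub>2_def fun_eq_iff by auto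
    moreover have "f = (\<lambda>x. 1 / (2 * d) * (\<mu>\<^sub>1 x - \<mu>\<^sub>2 x))" "g = (\<lambda>x. (\<mu>\<^sub>1 x + \<mu>\<^sub>2 x) / 2)"
      using d(2) unfolding \<mu>\<^sub>1_def \<mu>\<^sub>2_def by auto
    ultimately have "two_character_form \<sigma> f g (1 / (2 * d)) \<mu>\<^sub>1 \<mu>\<^sub>2"
      unfolding two_character_form_def using d(2) by simp
    then show ?thesis
      by blast
  qed
qed

section \<open>Classification, commutativity and continuity\<close>

lemma sine_equation_cases:
  assumes "semigroup_automorphism \<sigma>" and "solves_sine_equation \<sigma> f g" and "f \<noteq> (\<lambda>_. 0)"
  shows "((\<forall>s \<in> semigroup_square. f s = 0) \<and> g = (\<lambda>_. 0))
      \<or> (\<exists>\<alpha> \<mu>. single_character_form \<sigma> f g \<alpha> \<mu>)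
      \<or> (\<exists>c \<mu>\<^sub>1 \<mu>\<^sub>2. two_character_form \<sigma> f g c \<mu>\<^sub>1 \<mu>\<^sub>2)
      \<or> (\<exists>\<mu> \<phi>. sine_addition_form \<sigma> f g \<mu> \<phi>)"
  using dependent_solution[OF assms] independent_solution[OF assms] by blast

lemma abelian_multiplicative:
  assumes "multiplicative \<mu>"
  shows "abelian \<mu>"
  using assms unfolding multiplicative_def abelian_def central_def by (simp add: mult.commute)

lemma abelian_linear_combination:
  assumes "abelian f" and "abelian g"
  shows "abelian (\<lambda>x. p * f x + q * g x)"
  using assms unfolding abelian_def central_def by metis

text \<open>The value at \<open>x * y * z\<close> is
  $\phi(x)\mu(y)\mu(z) + \mu(x)\phi(y)\mu(z) + \mu(x)\mu(y)\phi(z)$, a symmetric expression.\<close>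

lemma abelian_sine_addition:
  assumes "multiplicative \<mu>" and "\<And>x y. \<phi> (x * y) = \<phi> x * \<mu> y + \<phi> y * \<mu> x"
  shows "abelian \<phi>"
  using assms unfolding multiplicative_def abelian_def central_def by (simp add: algebra_simps)

lemma abelian_solution:
  assumes "semigroup_automorphism \<sigma>" and "solves_sine_equation \<sigma> f g" and "f \<noteq> (\<lambda>_. 0)"
  shows "abelian f" and "abelian g"
proof -
  consider (square) "\<forall>s \<in> semigroup_square. f s = 0" "g = (\<lambda>_. 0)"
    | (single) \<alpha> \<mu> where "single_character_form \<sigma> f g \<alpha> \<mu>"
    | (two) c \<mu>\<^sub>1 \<mu>\<^sub>2 where "two_character_form \<sigma> f g c \<mu>\<^sub>1 \<mu>\<^sub>2"
    | (sine) \<mu> \<phi> where "sine_addition_form \<sigma> f g \<mu> \<phi>"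
    using sine_equation_cases[OF assms] by blast
  then have "abelian f \<and> abelian g"
  proof cases
    case square
    then have "f (x * y) = 0" for x y
      unfolding semigroup_square_def by auto
    then show ?thesis
      using square(2) unfolding abelian_def central_def by simp
  next
    case single
    then have "abelian \<mu>" "f = (\<lambda>x. 1 / (2 * \<alpha>) * \<mu> x + 0 * \<mu> x)" "g = (\<lambda>x. 1 / 2 * \<mu> x + 0 * \<mu> x)"
      unfolding single_character_form_def by (auto intro: abelian_multiplicative)
    then show ?thesis
      by (metis abelian_linear_combination)
  next
    case two
    then have "abelian \<mu>\<^sub>1" "abelian \<mu>\<^sub>2"
      unfolding two_character_form_def by (auto intro: abelian_multiplicative)
    moreover have "f = (\<lambda>x. c * \<mu>\<^sub>1 x + (- c) * \<mu>\<^sub>2 x)" "g = (\<lambda>x. 1 / 2 * \<mu>\<^sub>1 x + 1 / 2 * \<mu>\<^sub>2 x)"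
      using two unfolding two_character_form_def by (auto simp: algebra_simps add_divide_distrib)
    ultimately show ?thesis
      by (metis abelian_linear_combination)
  next
    case sine
    then show ?thesis
      unfolding sine_addition_form_def
      by (auto intro: abelian_multiplicative abelian_sine_addition)
  qed
  then show "abelian f" and "abelian g"
    by auto
qed

lemma continuous_functions_linear_combination:
  assumes "f \<in> continuous_functions T" and "g \<in> continuous_functions T"
  shows "(\<lambda>x. p * f x + q * g x) \<in> continuous_functions T"
proof -
  have scale: "continuous_map euclidean euclidean (\<lambda>z::complex. r * z)" for r
    by (simp add: continuous_intros)
  show ?thesis
    using continuous_map_compose[OF _ scale[of p], of T f]
      continuous_map_compose[OF _ scale[of q], of T g] assms
    unfolding continuous_functions_def by (auto simp: o_def intro: continuous_map_add)
qed

lemma continuous_map_right_translation: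
  assumes "topological_semigroup T"
  shows "continuous_map T T (\<lambda>x. x * s)"
proof -
  have "s \<in> topspace T" and mult: "continuous_map (prod_topology T T) T (\<lambda>(x, y). x * y)"
    using assms unfolding topological_semigroup_def by auto
  then have "continuous_map T (prod_topology T T) (\<lambda>x. (x, s))"
    by (simp add: continuous_map_pairedI)
  from continuous_map_compose[OF this mult] show ?thesis
    by (simp add: o_def)
qed

lemma continuous_second_component:
  assumes sol: "solves_sine_equation \<sigma> f g" and nz: "f \<noteq> (\<lambda>_. 0)"
    and T: "topological_semigroup T" and f: "f \<in> continuous_functions T"
  shows "g \<in> continuous_functions T"
proof -
  obtain y where y: "f y \<noteq> 0"
    using nz by auto
  have "f (x * \<sigma> y) = f x * g y + f y * g x" for x
    using sol unfolding solves_sine_equation_def by blast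
  then have g: "g = (\<lambda>x. 1 / f y * f (x * \<sigma> y) + (- g y / f y) * f x)"
    using y by (auto simp: fun_eq_iff field_simps)
  have "(\<lambda>x. f (x * \<sigma> y)) \<in> continuous_functions T"
    using continuous_map_compose[OF continuous_map_right_translation[OF T, of "\<sigma> y"]] f
    unfolding continuous_functions_def by (auto simp: o_def)
  from continuous_functions_linear_combination[OF this f, of "1 / f y" "- g y / f y"]
  show ?thesis
    by (simp only: g[symmetric])
qed

lemma continuous_components:
  assumes f: "f \<in> continuous_functions T" and g: "g \<in> continuous_functions T"
  shows "single_character_form \<sigma> f g \<alpha> \<mu> \<Longrightarrow> \<mu> \<in> continuous_functions T"
    and "two_character_form \<sigma> f g c \<mu>\<^sub>1 \<mu>\<^sub>2 \<Longrightarrow>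
          \<mu>\<^sub>1 \<in> continuous_functions T \<and> \<mu>\<^sub>2 \<in> continuous_functions T"
    and "sine_addition_form \<sigma> f g \<mu> \<phi> \<Longrightarrow>
          \<mu> \<in> continuous_functions T \<and> \<phi> \<in> continuous_functions T"
proof -
  note combination = continuous_functions_linear_combination[OF f g]
  show "\<mu> \<in> continuous_functions T" if "single_character_form \<sigma> f g \<alpha> \<mu>"
  proof -
    have "\<mu> = (\<lambda>x. 0 * f x + 2 * g x)"
      using that unfolding single_character_form_def by auto
    then show ?thesis
      by (metis combination)
  qed
  show "\<mu>\<^sub>1 \<in> continuous_functions T \<and> \<mu>\<^sub>2 \<in> continuous_functions T"
    if "two_character_form \<sigma> f g c \<mu>\<^sub>1 \<mu>\<^sub>2"
  proof -
    have "\<mu>\<^sub>1 = (\<lambda>x. 1 / (2 * c) * f x + 1 * g x)" "\<mu>\<^sub>2 = (\<lambda>x. - 1 / (2 * c) * f x + 1 * g x)"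
      using that unfolding two_character_form_def by (auto simp: fun_eq_iff field_simps)
    then show ?thesis
      by (metis combination)
  qed
  show "\<mu> \<in> continuous_functions T \<and> \<phi> \<in> continuous_functions T"
    if "sine_addition_form \<sigma> f g \<mu> \<phi>"
    using that f g unfolding sine_addition_form_def by auto
qed

theorem theorem4p3:
  fixes \<sigma> :: "'a::semigroup_mult \<Rightarrow> 'a" and f g :: "'a \<Rightarrow> complex"
  assumes "semigroup_automorphism \<sigma>"
  shows
    "(solves_sine_equation \<sigma> f g \<longleftrightarrow>
        f = (\<lambda>_. 0)
      \<or> (f \<noteq> (\<lambda>_. 0) \<and> (\<forall>s \<in> semigroup_square. f s = 0) \<and> g = (\<lambda>_. 0))
      \<or> (\<exists>\<alpha> \<mu>. single_character_form \<sigma> f g \<alpha> \<mu>)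
      \<or> (\<exists>c \<mu>\<^sub>1 \<mu>\<^sub>2. two_character_form \<sigma> f g c \<mu>\<^sub>1 \<mu>\<^sub>2)
      \<or> (\<exists>\<mu> \<phi>. sine_addition_form \<sigma> f g \<mu> \<phi>))
     \<and>
     (solves_sine_equation \<sigma> f g \<and> f \<noteq> (\<lambda>_. 0) \<longrightarrow> abelian f \<and> abelian g)
     \<and>
     (\<forall>T. solves_sine_equation \<sigma> f g \<and> f \<noteq> (\<lambda>_. 0)
           \<and> topological_semigroup T \<and> f \<in> continuous_functions T \<longrightarrow>
        g \<in> continuous_functions T
      \<and> (\<forall>\<alpha> \<mu>. single_character_form \<sigma> f g \<alpha> \<mu> \<longrightarrow> \<mu> \<in> continuous_functions T)
      \<and> (\<forall>c \<mu>\<^sub>1 \<mu>\<^sub>2. two_character_form \<sigma> f g c \<mu>\<^sub>1 \<mu>\<^sub>2 \<longrightarrow>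
            \<mu>\<^sub>1 \<in> continuous_functions T \<and> \<mu>\<^sub>2 \<in> continuous_functions T)
      \<and> (\<forall>\<mu> \<phi>. sine_addition_form \<sigma> f g \<mu> \<phi> \<longrightarrow>
            \<mu> \<in> continuous_functions T \<and> \<phi> \<in> continuous_functions T))"
proof (intro conjI)
  show "solves_sine_equation \<sigma> f g \<longleftrightarrow>
        f = (\<lambda>_. 0)
      \<or> (f \<noteq> (\<lambda>_. 0) \<and> (\<forall>s \<in> semigroup_square. f s = 0) \<and> g = (\<lambda>_. 0))
      \<or> (\<exists>\<alpha> \<mu>. single_character_form \<sigma> f g \<alpha> \<mu>)
      \<or> (\<exists>c \<mu>\<^sub>1 \<mu>\<^sub>2. two_character_form \<sigma> f g c \<mu>\<^sub>1 \<mu>\<^sub>2)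
      \<or> (\<exists>\<mu> \<phi>. sine_addition_form \<sigma> f g \<mu> \<phi>)" (is "?sol \<longleftrightarrow> ?cases")
  proof
    assume ?sol
    then show ?cases
      using sine_equation_cases[OF assms] by blast
  next
    assume ?cases
    then show ?sol
    proof (elim disjE exE conjE)
      assume "f = (\<lambda>_. 0)"
      then show ?sol
        unfolding solves_sine_equation_def by simp
    qed (erule (1) solves_sine_equation_if_zero_on_square
        | erule solves_sine_equation_if_single_character
        | erule solves_sine_equation_if_two_character
        | erule solves_sine_equation_if_sine_addition)+
  qed
next
  show "solves_sine_equation \<sigma> f g \<and> f \<noteq> (\<lambda>_. 0) \<longrightarrow> abelian f \<and> abelian g"
    using abelian_solution[OF assms] by blast
next
  show "\<forall>T. solves_sine_equation \<sigma> f g \<and> f \<noteq> (\<lambda>_. 0)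
           \<and> topological_semigroup T \<and> f \<in> continuous_functions T \<longrightarrow>
        g \<in> continuous_functions T
      \<and> (\<forall>\<alpha> \<mu>. single_character_form \<sigma> f g \<alpha> \<mu> \<longrightarrow> \<mu> \<in> continuous_functions T)
      \<and> (\<forall>c \<mu>\<^sub>1 \<mu>\<^sub>2. two_character_form \<sigma> f g c \<mu>\<^sub>1 \<mu>\<^sub>2 \<longrightarrow>
            \<mu>\<^sub>1 \<in> continuous_functions T \<and> \<mu>\<^sub>2 \<in> continuous_functions T)
      \<and> (\<forall>\<mu> \<phi>. sine_addition_form \<sigma> f g \<mu> \<phi> \<longrightarrow>
            \<mu> \<in> continuous_functions T \<and> \<phi> \<in> continuous_functions T)"
  proof (intro allI impI, elim conjE)
    fix T :: "'a topology"
    assume "solves_sine_equation \<sigma> f g" "f \<noteq> (\<lambda>_. 0)"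
      "topological_semigroup T" and f: "f \<in> continuous_functions T"
    then have g: "g \<in> continuous_functions T"
      by (rule continuous_second_component)
    then show "g \<in> continuous_functions T
      \<and> (\<forall>\<alpha> \<mu>. single_character_form \<sigma> f g \<alpha> \<mu> \<longrightarrow> \<mu> \<in> continuous_functions T)
      \<and> (\<forall>c \<mu>\<^sub>1 \<mu>\<^sub>2. two_character_form \<sigma> f g c \<mu>\<^sub>1 \<mu>\<^sub>2 \<longrightarrow>
            \<mu>\<^sub>1 \<in> continuous_functions T \<and> \<mu>\<^sub>2 \<in> continuous_functions T)
      \<and> (\<forall>\<mu> \<phi>. sine_addition_form \<sigma> f g \<mu> \<phi> \<longrightarrow>
            \<mu> \<in> continuous_functions T \<and> \<phi> \<in> continuous_functions T)"
      using g by (auto dest: continuous_components[OF f g])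
  qed
qed

end
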